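(* Let $A\subset\mathbb{Z}^m$ be a configuration of $n=m+d$ vectors that spans $\mathbb{Z}^m$, lies on an affine hyperplane, and is not a pyramid, with Gale dual $B\subset\mathbb{Z}^d$. Then the closed coamoeba of the dual variety $X_A^*$ is $$\overline{c\mathscr{A}\bigl(X^*_A\cap(\mathbb{C}^\times)^A\bigr)}=\mathbb{T}_A\cdot\overline{c\mathscr{A}(\mathcal{H}^c_B)},$$ and moreover $\overline{c\mathscr{A}(D_B)}=\varphi_B\bigl(\overline{c\mathscr{A}(\mathcal{H}^c_B)}\bigr)$ and $\mathscr{P}^\infty(D_B)\subset\varphi_B\bigl(\mathscr{P}^\infty(\mathcal{H}_B^c)\bigr)$.
   Context: $\mathbb{T}\subset\mathbb{C}$ is the unit circle; $\mathrm{Arg}$, $\mathrm{Log}$ are coordinatewise $z\mapsto z/|z|$, $z\mapsto\log|z|$; the coamoeba of $X\subset(\mathbb{C}^\times)^k$ is $c\mathscr{A}(X)=\mathrm{Arg}(X)$. $A$ is a multiset with $\langle u,a\rangle=1$ for all $a\in A$ for some integer vector $u$. The kernel of $\mathbb{Z}^A\to\mathbb{Z}^m$, $(c_a)\mapsto\sum c_a a$, is free of rank $d$; an isomorphism $\mathbb{Z}^d\to$ kernel has the form $y\mapsto(\langle b_a,y\rangle)_{a\in A}$, and the multiset $B=\{b_a:a\in A\}\subset\mathbb{Z}^d$ is a Gale dual of $A$; it has sum zero. "Not a pyramid" means that all $b_a$ are nonzero. Coordinates indexed by $A$ and by $B$ are identified. $\varphi_A\colon(\mathbb{C}^\times)^m\to(\mathbb{C}^\times)^A$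 is $x\mapsto(x^a)_{a\in A}$, $Y_A$ is its image, and $\mathbb{T}_A:=\varphi_A(\mathbb{T}^m)\subset\mathbb{T}^A$. The dual variety $X_A^*$ is the closure, in the dual space $\check{\mathbb{C}}^A\cong\mathbb{C}^A$ of linear forms $(c_a)_{a\in A}$, of the set of forms (hyperplanes) vanishing on a tangent space $T_zY_A$, $z\in Y_A$. $\mathcal{H}_B$ is the central arrangement in $\mathbb{C}^d$ defined by the forms $b\in B$, $\mathcal{H}_B^c\subset(\mathbb{C}^\times)^A$ is the image of $\mathbb{C}^d\smallsetminus\mathcal{H}_B$ under $\lambda_B(y)=(\langle b_a,y\rangle)_{a\in A}$, $\varphi_B\colon(\mathbb{C}^\times)^A\to(\mathbb{C}^\times)^d$ is $(z_a)\mapsto\prod_a z_a^{b_a}$ with $t^b=(t^{b_1},\dots,t^{b_d})$ (also denoting the induced map $\mathbb{T}^A\to\mathbb{T}^d$), and the reduced discriminant $D_B$ is the closure of $\varphi_B(\mathcal{H}_B^c)$ in $(\mathbb{C}^\times)^d$. Phase limit sets: $\mathscr{P}^\infty(D_B)$ is the set of limits $\lim_i\mathrm{Arg}(y_i)$ over sequences $(y_i)\subset D_B$ with $\|\mathrm{Log}(y_i)\|\to\infty$ and $\mathrm{Arg}(y_i)$ convergent. As $\mathcal{H}^c_B$ is stable under scaling, $\mathscr{P}^\infty(\mathcal{H}_B^c)$ is the set of such limits over sequences $(z_i)\subset\mathcal{H}_B^c$ for which the class of $\mathrm{Log}(z_i)$ in $\mathbb{R}^A/\mathbb{R}(1,\dots,1)$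 tends to infinity. *)

theory Defs
  imports "HOL-Analysis.Analysis"
begin

text \<open>
  A multiset of vectors is a family \<open>'n \<Rightarrow> int ^ 'm\<close> over a finite index type, so that repetitions are
  allowed. The coordinates of \<open>complex ^ 'n\<close> are indexed by the same type \<open>'n\<close>, for \<open>A\<close> and for its
  Gale dual \<open>B\<close>. The product \<open>*\<close> on \<open>complex ^ 'n\<close> is the coordinatewise one.
\<close>

definition pairing :: "int ^ 'k \<Rightarrow> ('r::comm_ring_1) ^ 'k \<Rightarrow> 'r"
  where "pairing b y = (\<Sum>i\<in>UNIV. of_int (b $ i) * y $ i)"

definition complex_torus :: "(complex ^ 'k) set"
  where "complex_torus = {z. \<forall>i. z $ i \<noteq> 0}"

definition compact_torus :: "(complex ^ 'k) set"
  where "compact_torus = {z. \<forall>i. norm (z $ i) = 1}"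

definition ArgV :: "complex ^ 'k \<Rightarrow> complex ^ 'k"
  where "ArgV z = (\<chi> i. z $ i / of_real (norm (z $ i)))"

definition LogV :: "complex ^ 'k \<Rightarrow> real ^ 'k"
  where "LogV z = (\<chi> i. ln (norm (z $ i)))"

definition coamoeba :: "(complex ^ 'k) set \<Rightarrow> (complex ^ 'k) set"
  where "coamoeba X = ArgV ` X"


definition spans_lattice :: "('n::finite \<Rightarrow> int ^ 'm) \<Rightarrow> bool"
  where "spans_lattice A \<longleftrightarrow> (\<forall>v. \<exists>c::int ^ 'n. v = (\<Sum>a\<in>UNIV. c $ a *s A a))"

definition on_affine_hyperplane :: "('n::finite \<Rightarrow> int ^ 'm) \<Rightarrow> bool"
  where "on_affine_hyperplane A \<longleftrightarrow> (\<exists>u::int ^ 'm. \<forall>a. pairing u (A a) = 1)"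

definition relation_lattice :: "('n::finite \<Rightarrow> int ^ 'm) \<Rightarrow> (int ^ 'n) set"
  where "relation_lattice A = {c. (\<Sum>a\<in>UNIV. c $ a *s A a) = 0}"

text \<open>The map below is additive by its form, so that bijectivity makes it an isomorphism.\<close>

definition gale_dual :: "('n::finite \<Rightarrow> int ^ 'm) \<Rightarrow> ('n \<Rightarrow> int ^ 'd) \<Rightarrow> bool"
  where "gale_dual A B \<longleftrightarrow>
    bij_betw (\<lambda>y::int ^ 'd. \<chi> a. pairing (B a) y) UNIV (relation_lattice A)"


definition phi_A :: "('n::finite \<Rightarrow> int ^ 'm) \<Rightarrow> complex ^ 'm \<Rightarrow> complex ^ 'n"
  where "phi_A A x = (\<chi> a. \<Prod>i\<in>UNIV. (x $ i) powi (A a $ i))"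

definition Y_A :: "('n::finite \<Rightarrow> int ^ 'm) \<Rightarrow> (complex ^ 'n) set"
  where "Y_A A = phi_A A ` complex_torus"

definition T_A :: "('n::finite \<Rightarrow> int ^ 'm) \<Rightarrow> (complex ^ 'n) set"
  where "T_A A = phi_A A ` compact_torus"

text \<open>
  Tangent vectors are the velocities at 0 of holomorphic curves in \<open>Y\<close> through \<open>z\<close>. This is the
  tangent space as a linear subspace when \<open>Y\<close> is a complex submanifold, as \<open>Y_A\<close> is below. There
  \<open>Y_A\<close> is moreover stable under scaling, so that the tangent space contains \<open>z\<close> and agrees with
  the affine tangent space.
\<close>

definition tangent_space :: "(complex ^ 'n) set \<Rightarrow> complex ^ 'n \<Rightarrow> (complex ^ 'n) set"
  where "tangent_space Y z =
    {v. \<exists>(\<gamma> :: complex \<Rightarrow> complex ^ 'n) U. open U \<and> 0 \<in> U \<and> (\<forall>a. (\<lambda>t. \<gamma> t $ a) holomorphic_on U)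
        \<and> \<gamma> ` U \<subseteq> Y \<and> \<gamma> 0 = z \<and> (\<forall>a. v $ a = deriv (\<lambda>t. \<gamma> t $ a) 0)}"

text \<open>
  The form with coefficients \<open>c\<close> is \<open>v \<mapsto> \<Sum>a. c a * v a\<close>. Closures here and in \<open>reduced_discriminant\<close>
  are taken in the usual topology; the sets being closed are images of algebraic maps, hence
  constructible, so these are also their Zariski closures.
\<close>

definition dual_variety :: "('n::finite \<Rightarrow> int ^ 'm) \<Rightarrow> (complex ^ 'n) set"
  where "dual_variety A =
    closure {c. \<exists>z\<in>Y_A A. \<forall>v\<in>tangent_space (Y_A A) z. (\<Sum>a\<in>UNIV. c $ a * v $ a) = 0}"


definition arrangement :: "('n::finite \<Rightarrow> int ^ 'd) \<Rightarrow> (complex ^ 'd) set"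
  where "arrangement B = (\<Union>a. {y. pairing (B a) y = 0})"

definition lambda_B :: "('n::finite \<Rightarrow> int ^ 'd) \<Rightarrow> complex ^ 'd \<Rightarrow> complex ^ 'n"
  where "lambda_B B y = (\<chi> a. pairing (B a) y)"

definition arrangement_compl :: "('n::finite \<Rightarrow> int ^ 'd) \<Rightarrow> (complex ^ 'n) set"
  where "arrangement_compl B = lambda_B B ` (- arrangement B)"

definition phi_B :: "('n::finite \<Rightarrow> int ^ 'd) \<Rightarrow> complex ^ 'n \<Rightarrow> complex ^ 'd"
  where "phi_B B z = (\<chi> i. \<Prod>a\<in>UNIV. (z $ a) powi (B a $ i))"

definition reduced_discriminant :: "('n::finite \<Rightarrow> int ^ 'd) \<Rightarrow> (complex ^ 'd) set"
  where "reduced_discriminant B = closure (phi_B B ` arrangement_compl B) \<inter> complex_torus"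


definition phase_limit_set :: "(complex ^ 'k) set \<Rightarrow> (complex ^ 'k) set"
  where "phase_limit_set X =
    {\<theta>. \<exists>y::nat \<Rightarrow> complex ^ 'k. (\<forall>i. y i \<in> X)
        \<and> filterlim (\<lambda>i. norm (LogV (y i))) at_top sequentially
        \<and> (\<lambda>i. ArgV (y i)) \<longlonglongrightarrow> \<theta>}"

text \<open>
  The variant for sets stable under scaling: the distance to the line spanned by \<open>(1,\<dots>,1)\<close> is the
  quotient norm of the class modulo that line.
\<close>

definition projective_phase_limit_set :: "(complex ^ 'k) set \<Rightarrow> (complex ^ 'k) set"
  where "projective_phase_limit_set X =
    {\<theta>. \<exists>z::nat \<Rightarrow> complex ^ 'k. (\<forall>i. z i \<in> X)
        \<and> filterlim (\<lambda>i. infdist (LogV (z i)) (range (\<lambda>s::real. \<chi> a. s))) at_top sequentially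
        \<and> (\<lambda>i. ArgV (z i)) \<longlonglongrightarrow> \<theta>}"

end

theory Submission
  imports Defs
begin

text \<open>
  The three claims rest on two facts. The first is the Horn-Kapranov parametrization: a form \<open>c\<close>
  vanishes on the tangent space of \<open>Y_A\<close> at \<open>z\<close> if and only if \<open>c * z\<close> is a complex linear relation
  among the vectors of \<open>A\<close>. Since \<open>A\<close> spans the lattice, the complex relations are spanned by the
  integer ones, so they are the image of \<open>\<lambda>\<^sub>B\<close>. As \<open>Y_A\<close> is a group, the set whose closure is the dual
  variety is \<open>Y_A * \<lambda>\<^sub>B(\<complex>\<^sup>d)\<close>, and it meets the torus in \<open>Y_A * \<H>\<^sub>B\<^sup>c\<close>
  (\<open>tangent_space_Y_A\<close>, \<open>complex_kernel_eq_range_lambda_B\<close>, \<open>dual_variety_eq_closure\<close>).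

  The second is that \<open>Arg\<close> is multiplicative, commutes with monomial maps, and maps the complex torus
  continuously to the compact one. Taking the closure of a set within the torus therefore does not
  change its closed coamoeba (\<open>closure_coamoeba_closure\<close>), and closures of subsets of the compact torus
  pass through products with the compact group \<open>T_A\<close> and through monomial maps
  (\<open>closure_continuous_image_compact\<close>). This yields both equalities.

  For the phase limit sets, a sequence in the discriminant is replaced by a nearby sequence
  \<open>\<phi>\<^sub>B(z\<^sub>i)\<close>, and compactness makes \<open>Arg(z\<^sub>i)\<close> converge along a subsequence. On logarithms \<open>\<phi>\<^sub>B\<close> is a
  linear map that kills \<open>(1,\<dots>,1)\<close>, because \<open>B\<close> has sum zero. Hence \<open>\<parallel>Log(\<phi>\<^sub>B(z\<^sub>i))\<parallel>\<close> is at most a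
  constant times the distance of \<open>Log(z\<^sub>i)\<close> from that line, and this distance tends to infinity as well
  (\<open>norm_LogV_phi_A_le\<close>, \<open>phase_limit_set_monomial_image\<close>).
\<close>

section \<open>Arguments and logarithms on the torus\<close>

lemma ArgV_nth: "ArgV z $ i = sgn (z $ i)"
  by (simp add: ArgV_def sgn_div_norm scaleR_conv_of_real divide_inverse mult.commute)

lemma ArgV_mult: "ArgV (x * y) = ArgV x * ArgV y"
  by (simp add: vec_eq_iff ArgV_nth sgn_mult)

lemma ArgV_in_compact_torus: "z \<in> complex_torus \<Longrightarrow> ArgV z \<in> compact_torus"
  by (simp add: complex_torus_def compact_torus_def ArgV_nth norm_sgn)

lemma ArgV_of_compact_torus: "z \<in> compact_torus \<Longrightarrow> ArgV z = z"
  by (simp add: compact_torus_def vec_eq_iff ArgV_def)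

lemma compact_torus_subset: "compact_torus \<subseteq> complex_torus"
proof
  fix z :: "complex ^ 'a" assume "z \<in> compact_torus"
  hence "norm (z $ i) = 1" for i by (simp add: compact_torus_def)
  hence "z $ i \<noteq> 0" for i by (metis norm_zero zero_neq_one)
  thus "z \<in> complex_torus" by (simp add: complex_torus_def)
qed

lemma coamoeba_subset: "X \<subseteq> complex_torus \<Longrightarrow> coamoeba X \<subseteq> compact_torus"
  unfolding coamoeba_def using ArgV_in_compact_torus by blast

lemma open_complex_torus: "open (complex_torus :: (complex ^ 'k) set)"
proof -
  have "complex_torus = (\<Inter>i. {z :: complex ^ 'k. z $ i \<noteq> 0})"
    by (auto simp: complex_torus_def)
  moreover have "open {z :: complex ^ 'k. z $ i \<noteq> 0}" for i
    by (intro open_Collect_neq continuous_intros)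
  ultimately show ?thesis by (metis (no_types, lifting) open_INT finite)
qed

lemma compact_compact_torus: "compact (compact_torus :: (complex ^ 'k) set)"
proof -
  have "compact_torus = (\<Inter>i. {z :: complex ^ 'k. norm (z $ i) = 1})"
    by (auto simp: compact_torus_def)
  moreover have "closed {z :: complex ^ 'k. norm (z $ i) = 1}" for i
    by (intro closed_Collect_eq continuous_intros)
  ultimately have "closed (compact_torus :: (complex ^ 'k) set)"
    by (metis (no_types, lifting) closed_INT)
  moreover have "norm z \<le> real CARD('k)" if "z \<in> compact_torus" for z :: "complex ^ 'k"
    using L2_set_le_sum[of UNIV "\<lambda>i. norm (z $ i)"] that
    by (simp add: norm_vec_def compact_torus_def)
  hence "bounded (compact_torus :: (complex ^ 'k) set)"
    by (auto simp: bounded_iff)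
  ultimately show ?thesis by (simp add: compact_eq_bounded_closed)
qed

lemma continuous_on_ArgV: "continuous_on complex_torus ArgV"
  unfolding ArgV_def by (intro continuous_intros) (auto simp: complex_torus_def)

lemma continuous_on_LogV: "continuous_on complex_torus LogV"
  unfolding LogV_def by (intro continuous_intros) (auto simp: complex_torus_def)

lemma closure_coamoeba_subset_compact_torus:
  assumes "X \<subseteq> complex_torus"
  shows "closure (coamoeba X) \<subseteq> compact_torus"
  using closure_minimal[OF coamoeba_subset[OF assms]]
    compact_imp_closed[OF compact_compact_torus] by blast

text \<open>
  The torus is open, so a torus point in the closure of \<open>S\<close> is a limit of torus points of \<open>S\<close>, and
  \<open>Arg\<close> is continuous there.
\<close>

lemma closure_coamoeba_closure:
  "closure (coamoeba (closure S \<inter> complex_torus)) = closure (coamoeba (S \<inter> complex_torus))"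
    (is "closure ?L = closure ?R")
proof
  let ?T = "closure S \<inter> complex_torus"
  have "\<exists>w. (\<forall>n. w n \<in> ?R) \<and> w \<longlonglongrightarrow> ArgV x" if x: "x \<in> ?T" for x
  proof -
    have "x \<in> closure (S \<inter> complex_torus)"
      using open_Int_closure_subset[OF open_complex_torus] x by (metis Int_commute subsetD)
    then obtain s where s: "\<And>n. s n \<in> S \<inter> complex_torus" "s \<longlonglongrightarrow> x"
      by (auto simp: closure_sequential)
    have "(\<lambda>n. ArgV (s n)) \<longlonglongrightarrow> ArgV x"
      using s x by (intro continuous_on_tendsto_compose[OF continuous_on_ArgV]) auto
    with s(1) show ?thesis
      by (intro exI[of _ "\<lambda>n. ArgV (s n)"]) (auto simp: coamoeba_def)
  qed
  hence "?L \<subseteq> closure ?R"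
    by (auto simp: coamoeba_def closure_sequential)
  thus "closure ?L \<subseteq> closure ?R" by (simp add: closure_minimal)
  show "closure ?R \<subseteq> closure ?L"
    unfolding coamoeba_def
    by (intro closure_mono image_mono Int_mono closure_subset order_refl)
qed

section \<open>Monomial maps\<close>

lemma sgn_powi: "sgn (z powi k) = sgn z powi k" for z :: complex
  by (simp add: sgn_eq norm_power_int power_int_divide_distrib of_real_power_int)

lemma sgn_prod_complex: "sgn (\<Prod>i\<in>I. f i) = (\<Prod>i\<in>I. sgn (f i))" for f :: "_ \<Rightarrow> complex"
  by (induction I rule: infinite_finite_induct) (auto simp: sgn_mult)

text \<open>
  Both maps are monomial maps, for transposed exponent matrices; so the facts below about \<open>phi_A M\<close>,
  with an arbitrary exponent matrix \<open>M\<close>, serve for both.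
\<close>

lemma phi_B_eq_phi_A: "phi_B B = phi_A (\<lambda>i. \<chi> a. B a $ i)"
  by (simp add: phi_B_def phi_A_def fun_eq_iff)

lemma phi_A_mult: "phi_A M (x * y) = phi_A M x * phi_A M y"
  by (simp add: phi_A_def vec_eq_iff power_int_mult_distrib prod.distrib)

lemma ArgV_phi_A: "ArgV (phi_A M x) = phi_A M (ArgV x)"
  by (simp add: vec_eq_iff ArgV_nth phi_A_def sgn_prod_complex sgn_powi)

lemma phi_A_in_complex_torus: "x \<in> complex_torus \<Longrightarrow> phi_A M x \<in> complex_torus"
  by (simp add: phi_A_def complex_torus_def power_int_eq_0_iff)

lemma continuous_on_phi_A: "continuous_on complex_torus (phi_A M)"
  unfolding phi_A_def by (intro continuous_intros) (auto simp: complex_torus_def)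

lemma phi_A_inverse:
  assumes "x \<in> complex_torus"
  shows "phi_A M x * phi_A M (\<chi> i. inverse (x $ i)) = 1"
proof -
  have "x * (\<chi> i. inverse (x $ i)) = 1"
    using assms by (simp add: vec_eq_iff complex_torus_def)
  hence "phi_A M x * phi_A M (\<chi> i. inverse (x $ i)) = phi_A M 1"
    by (simp add: phi_A_mult[symmetric])
  thus ?thesis by (simp add: phi_A_def vec_eq_iff)
qed

lemma LogV_phi_A:
  assumes "x \<in> complex_torus"
  shows "LogV (phi_A M x) $ a = pairing (M a) (LogV x)"
proof -
  have nz: "norm (x $ i) > 0" for i
    using assms by (simp add: complex_torus_def)
  have ln_powi: "ln (r powi k) = of_int k * ln r" if "r > 0" for r :: real and k
    using that by (simp add: powr_real_of_int' [symmetric] ln_powr)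
  have "ln (\<Prod>i\<in>UNIV. norm (x $ i) powi (M a $ i)) = (\<Sum>i\<in>UNIV. ln (norm (x $ i) powi (M a $ i)))"
    using nz by (intro ln_prod) (auto simp: power_int_eq_0_iff)
  also have "\<dots> = pairing (M a) (LogV x)"
    by (simp add: ln_powi[OF nz] pairing_def LogV_def)
  finally show ?thesis
    by (simp add: LogV_def phi_A_def prod_norm[symmetric] norm_power_int)
qed

lemma phi_A_compose:
  fixes M :: "'n::finite \<Rightarrow> int ^ 'm::finite" and C :: "'k::finite \<Rightarrow> int ^ 'n"
  assumes "x \<in> complex_torus"
  shows "phi_A C (phi_A M x) = phi_A (\<lambda>i. \<Sum>a\<in>UNIV. C i $ a *s M a) x"
proof -
  have prod_powi: "(\<Prod>j\<in>J. f j) powi k = (\<Prod>j\<in>J. f j powi k)"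
    for f :: "'m \<Rightarrow> complex" and J k
    by (induction J rule: infinite_finite_induct) (auto simp: power_int_mult_distrib)
  have powi_sum: "y powi (\<Sum>a\<in>J. k a) = (\<Prod>a\<in>J. y powi k a)" if "y \<noteq> 0"
    for y :: complex and J and k :: "'n \<Rightarrow> int"
    using that by (induction J rule: infinite_finite_induct) (auto simp: power_int_add)
  have nz: "x $ j \<noteq> 0" for j using assms by (simp add: complex_torus_def)
  have "(\<Prod>a\<in>UNIV. (\<Prod>j\<in>UNIV. x $ j powi (M a $ j)) powi (C i $ a)) =
        (\<Prod>j\<in>UNIV. x $ j powi (\<Sum>a\<in>UNIV. C i $ a * M a $ j))" for i
    unfolding prod_powi powi_sum[OF nz] power_int_mult[symmetric]
    by (subst prod.swap) (simp add: mult.commute)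
  thus ?thesis
    by (simp add: phi_A_def vec_eq_iff)
qed

text \<open>
  The logarithmic derivative of a monomial is the linear form of its exponents in the logarithmic
  derivatives of the variables.
\<close>

lemma phi_A_has_derivative:
  fixes g :: "complex \<Rightarrow> complex ^ 'm"
  assumes g: "\<And>i. ((\<lambda>t. g t $ i) has_field_derivative D i) (at t)"
    and nz: "g t \<in> complex_torus"
  shows "((\<lambda>t. phi_A M (g t) $ a) has_field_derivative
           phi_A M (g t) $ a * pairing (M a) (\<chi> i. D i / g t $ i)) (at t)"
proof -
  have nz: "g t $ i \<noteq> 0" for i using nz by (simp add: complex_torus_def)
  have "((\<lambda>t. g t $ i powi k) has_field_derivative of_int k * g t $ i powi (k - 1) * D i) (at t)"
    for i k
    using nz by (intro DERIV_power_int g) auto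
  moreover have "g t $ i powi k \<noteq> 0" for i k
    by (simp add: nz power_int_eq_0_iff)
  ultimately have "((\<lambda>t. \<Prod>i\<in>UNIV. g t $ i powi (M a $ i)) has_field_derivative
     (\<Prod>i\<in>UNIV. g t $ i powi (M a $ i)) *
     (\<Sum>i\<in>UNIV. of_int (M a $ i) * g t $ i powi (M a $ i - 1) * D i / g t $ i powi (M a $ i))) (at t)"
    by (intro has_field_derivative_prod')
  thus ?thesis
    by (simp add: phi_A_def pairing_def power_int_diff nz power_int_eq_0_iff)
qed

section \<open>The conormal vectors of the torus orbit\<close>

lemma spans_lattice_coefficients:
  fixes A :: "'n::finite \<Rightarrow> int ^ 'm::finite"
  assumes "spans_lattice A"
  shows "\<exists>C :: 'm \<Rightarrow> int ^ 'n. \<forall>i. (\<Sum>a\<in>UNIV. C i $ a *s A a) = axis i 1"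
proof -
  have "\<forall>i. \<exists>c :: int ^ 'n. (\<Sum>a\<in>UNIV. c $ a *s A a) = axis i 1"
    using assms unfolding spans_lattice_def by metis
  thus ?thesis by (rule choice)
qed

text \<open>
  Integer coefficients that express the unit vectors through \<open>A\<close> are exponents of a monomial map that
  inverts \<open>phi_A A\<close> on its image. It will lift holomorphic curves in \<open>Y_A\<close> to the torus.
\<close>

lemma phi_A_left_inverse:
  fixes A :: "'n::finite \<Rightarrow> int ^ 'm::finite" and C :: "'m \<Rightarrow> int ^ 'n"
  assumes C: "\<forall>i. (\<Sum>a\<in>UNIV. C i $ a *s A a) = axis i 1" and x: "x \<in> complex_torus"
  shows "phi_A C (phi_A A x) = x"
proof -
  have "(\<Prod>j\<in>UNIV. x $ j powi (axis i 1 $ j)) = x $ i" for i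
    by (subst prod.remove[of _ i]) (auto simp: axis_def intro!: prod.neutral)
  thus ?thesis
    by (simp add: phi_A_compose[OF x] C) (simp add: phi_A_def vec_eq_iff)
qed

text \<open>
  A curve in \<open>Y_A\<close> is \<open>phi_A A\<close> of its lift, which is holomorphic as a monomial in the curve; the
  logarithmic derivative of the lift is the required \<open>w\<close>. Conversely, \<open>w\<close> is realized by the
  one-parameter subgroup with velocity \<open>w\<close>, translated by \<open>x\<close>.
\<close>

lemma tangent_space_Y_A:
  fixes A :: "'n::finite \<Rightarrow> int ^ 'm::finite"
  assumes spans: "spans_lattice A" and x: "x \<in> complex_torus"
  shows "tangent_space (Y_A A) (phi_A A x) = range (\<lambda>w. \<chi> a. phi_A A x $ a * pairing (A a) w)"
proof (intro equalityI subsetI)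
  fix v assume "v \<in> tangent_space (Y_A A) (phi_A A x)"
  then obtain \<gamma> U where U: "open U" "0 \<in> U"
    and hol: "\<And>a. (\<lambda>t. \<gamma> t $ a) holomorphic_on U"
    and im: "\<gamma> ` U \<subseteq> Y_A A" and \<gamma>0: "\<gamma> 0 = phi_A A x"
    and v: "\<And>a. v $ a = deriv (\<lambda>t. \<gamma> t $ a) 0"
    unfolding tangent_space_def by blast
  from spans_lattice_coefficients[OF spans] obtain C :: "'m \<Rightarrow> int ^ 'n"
    where "\<forall>i. (\<Sum>a\<in>UNIV. C i $ a *s A a) = axis i 1" ..
  note C = phi_A_left_inverse[OF this]
  \<comment> \<open>the lift of the curve to the torus\<close>
  define \<xi> where "\<xi> t = phi_A C (\<gamma> t)" for t
  have \<gamma>: "\<gamma> t = phi_A A (\<xi> t)" if "t \<in> U" for t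
  proof -
    have "\<gamma> t \<in> phi_A A ` complex_torus" using im that by (auto simp: Y_A_def)
    then obtain y where "\<gamma> t = phi_A A y" "y \<in> complex_torus" by (rule imageE)
    thus ?thesis by (simp add: \<xi>_def C)
  qed
  have \<gamma>': "((\<lambda>t. \<gamma> t $ a) has_field_derivative v $ a) (at 0)" for a
    using holomorphic_derivI[OF hol U(1) U(2), of a] v by simp
  have \<xi>0: "\<xi> 0 = x" by (simp add: \<xi>_def \<gamma>0 C x)
  define w where "w = (\<chi> i. pairing (C i) (\<chi> a. v $ a / \<gamma> 0 $ a))"
  have "((\<lambda>t. \<xi> t $ i) has_field_derivative x $ i * w $ i) (at 0)" for i
    using phi_A_has_derivative[OF \<gamma>', of C i] x \<xi>0
    by (simp add: \<xi>_def \<gamma>0 phi_A_in_complex_torus w_def)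
  moreover have "x $ i \<noteq> 0" for i using x by (simp add: complex_torus_def)
  ultimately have "((\<lambda>t. phi_A A (\<xi> t) $ a) has_field_derivative
      phi_A A x $ a * pairing (A a) w) (at 0)" for a
    using phi_A_has_derivative[of \<xi> "\<lambda>i. x $ i * w $ i" 0 A a] x \<xi>0 by simp
  hence "((\<lambda>t. \<gamma> t $ a) has_field_derivative phi_A A x $ a * pairing (A a) w) (at 0)" for a
    by (rule has_field_derivative_transform_within_open[OF _ U]) (simp add: \<gamma>)
  hence "v $ a = phi_A A x $ a * pairing (A a) w" for a
    using \<gamma>' DERIV_unique by blast
  thus "v \<in> range (\<lambda>w. \<chi> a. phi_A A x $ a * pairing (A a) w)"
    by (auto simp: vec_eq_iff)
next
  fix v assume "v \<in> range (\<lambda>w. \<chi> a. phi_A A x $ a * pairing (A a) w)"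
  then obtain w where "v = (\<chi> a. phi_A A x $ a * pairing (A a) w)" ..
  hence v: "v $ a = phi_A A x $ a * pairing (A a) w" for a by simp
  define \<xi> where "\<xi> t = (\<chi> i. x $ i * exp (t * w $ i))" for t :: complex
  have \<xi>: "\<xi> t \<in> complex_torus" for t
    using x by (simp add: \<xi>_def complex_torus_def)
  have \<xi>': "((\<lambda>t. \<xi> t $ i) has_field_derivative \<xi> t $ i * w $ i) (at t)" for t i
    unfolding \<xi>_def by (auto intro!: derivative_eq_intros)
  have "((\<lambda>t. phi_A A (\<xi> t) $ a) has_field_derivative
      phi_A A (\<xi> t) $ a * pairing (A a) w) (at t)" for t a
  proof -
    have "(\<chi> i. \<xi> t $ i * w $ i / \<xi> t $ i) = w"
      using \<xi>[of t] by (simp add: complex_torus_def vec_eq_iff)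
    thus ?thesis using phi_A_has_derivative[OF \<xi>' \<xi>, where M = A and a = a and t = t] by simp
  qed
  note der = this
  have \<xi>0: "\<xi> 0 = x" by (simp add: \<xi>_def vec_eq_iff)
  have "(\<lambda>t. phi_A A (\<xi> t) $ a) holomorphic_on UNIV" for a
    using der by (metis field_differentiable_def field_differentiable_at_within holomorphic_onI)
  moreover have "(\<lambda>t. phi_A A (\<xi> t)) ` UNIV \<subseteq> Y_A A" using \<xi> by (auto simp: Y_A_def)
  moreover have "v $ a = deriv (\<lambda>t. phi_A A (\<xi> t) $ a) 0" for a
    using DERIV_imp_deriv[OF der[of a 0]] by (simp add: v \<xi>0)
  ultimately show "v \<in> tangent_space (Y_A A) (phi_A A x)"
    unfolding tangent_space_def using \<xi>0
    by (intro CollectI exI[of _ "\<lambda>t. phi_A A (\<xi> t)"] exI[of _ UNIV]) auto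
qed

text \<open>
  The form applied to the tangent vector with parameter \<open>w\<close> is linear in \<open>w\<close>, and its coefficients are
  the coordinates of \<open>\<Sum>a. c a * z a * A a\<close>, where \<open>z\<close> is the point \<open>phi_A A x\<close>.
\<close>

lemma annihilates_tangent_space_iff:
  fixes A :: "'n::finite \<Rightarrow> int ^ 'm::finite"
  assumes "spans_lattice A" and "x \<in> complex_torus"
  shows "(\<forall>v\<in>tangent_space (Y_A A) (phi_A A x). (\<Sum>a\<in>UNIV. c $ a * v $ a) = 0) \<longleftrightarrow>
         (\<forall>i. (\<Sum>a\<in>UNIV. (c * phi_A A x) $ a * of_int (A a $ i)) = 0)"
proof -
  let ?k = "c * phi_A A x"
  have swap: "(\<Sum>a\<in>UNIV. c $ a * (phi_A A x $ a * pairing (A a) w)) =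
      (\<Sum>i\<in>UNIV. (\<Sum>a\<in>UNIV. ?k $ a * of_int (A a $ i)) * w $ i)" for w
    unfolding pairing_def sum_distrib_left sum_distrib_right
    by (subst sum.swap) (simp add: mult_ac)
  have "(\<forall>w :: complex ^ 'm. (\<Sum>i\<in>UNIV. f i * w $ i) = 0) \<longleftrightarrow> (\<forall>i. f i = 0)"
    for f :: "'m \<Rightarrow> complex"
  proof
    assume w: "\<forall>w :: complex ^ 'm. (\<Sum>i\<in>UNIV. f i * w $ i) = 0"
    have "(\<Sum>i\<in>UNIV. f i * axis j 1 $ i) = f j" for j
      by (subst sum.remove[of _ j]) (auto simp: axis_def intro!: sum.neutral)
    with w show "\<forall>i. f i = 0" by metis
  qed simp
  thus ?thesis
    by (simp add: tangent_space_Y_A[OF assms] swap)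
qed

section \<open>Gale duality over the complex numbers\<close>

lemma pairing_of_int:
  "pairing b (\<chi> j. of_int (y $ j)) = (of_int (pairing b y) :: 'r::comm_ring_1)"
  by (simp add: pairing_def)

text \<open>
  The columns of \<open>B\<close> are the images of the unit vectors under the Gale isomorphism.
\<close>

lemma gale_dual_column:
  assumes "gale_dual A B"
  shows "(\<Sum>a\<in>UNIV. B a $ j * A a $ i) = 0"
proof -
  have "(\<Sum>i\<in>UNIV. b $ i * axis j 1 $ i) = b $ j" for b :: "int ^ 'c"
    by (subst sum.remove[of _ j]) (auto simp: axis_def intro!: sum.neutral)
  hence "(\<chi> a. B a $ j) = (\<chi> a. pairing (B a) (axis j 1))"
    by (simp add: pairing_def)
  also have "\<dots> \<in> relation_lattice A"
    using assms by (auto simp: gale_dual_def bij_betw_def)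
  finally have "(\<Sum>a\<in>UNIV. B a $ j *s A a) $ i = 0"
    by (simp add: relation_lattice_def)
  thus ?thesis by simp
qed

text \<open>
  Pairing a relation among the vectors of \<open>A\<close> with the functional that takes the value 1 on all of
  them gives the sum of the coefficients of the relation.
\<close>

lemma gale_dual_sum_eq_0:
  assumes "gale_dual A B" and "on_affine_hyperplane A"
  shows "(\<Sum>a\<in>UNIV. B a $ j) = 0"
proof -
  obtain u where u: "\<And>a. pairing u (A a) = 1"
    using assms(2) unfolding on_affine_hyperplane_def by blast
  have "(\<Sum>a\<in>UNIV. B a $ j) = (\<Sum>a\<in>UNIV. B a $ j * pairing u (A a))" by (simp add: u)
  also have "\<dots> = (\<Sum>i\<in>UNIV. u $ i * (\<Sum>a\<in>UNIV. B a $ j * A a $ i))"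
    unfolding pairing_def sum_distrib_left by (subst sum.swap) (simp add: mult_ac)
  finally show ?thesis by (simp add: gale_dual_column[OF assms(1)])
qed

text \<open>
  For the inclusion of the kernel in the range, let \<open>C i\<close> be integer coefficients of the \<open>i\<close>-th unit
  vector in terms of \<open>A\<close>. Then \<open>r a\<close>, the \<open>a\<close>-th unit vector minus \<open>\<Sum>i. A a i * C i\<close>, is an integer
  relation. In \<open>\<Sum>a. k a * r a\<close> with \<open>k\<close> in the complex kernel the subtracted terms cancel, so this sum
  is \<open>k\<close>: integer relations span the complex ones.
\<close>

lemma complex_kernel_eq_range_lambda_B:
  fixes A :: "'n::finite \<Rightarrow> int ^ 'm::finite" and B :: "'n \<Rightarrow> int ^ 'd::finite"
  assumes spans: "spans_lattice A" and gale: "gale_dual A B"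
  shows "{k. \<forall>i. (\<Sum>a\<in>UNIV. k $ a * of_int (A a $ i)) = 0} = range (lambda_B B)"
proof (intro equalityI subsetI)
  fix k :: "complex ^ 'n"
  assume "k \<in> range (lambda_B B)"
  then obtain y where k: "\<And>a. k $ a = pairing (B a) y" by (auto simp: lambda_B_def)
  have "(\<Sum>a\<in>UNIV. k $ a * of_int (A a $ i)) =
      (\<Sum>j\<in>UNIV. y $ j * of_int (\<Sum>a\<in>UNIV. B a $ j * A a $ i))" for i
    unfolding k pairing_def sum_distrib_left sum_distrib_right of_int_sum
    by (subst sum.swap) (simp add: mult_ac)
  thus "k \<in> {k. \<forall>i. (\<Sum>a\<in>UNIV. k $ a * of_int (A a $ i)) = 0}"
    by (simp add: gale_dual_column[OF gale])
next
  fix k :: "complex ^ 'n"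
  assume "k \<in> {k. \<forall>i. (\<Sum>a\<in>UNIV. k $ a * of_int (A a $ i)) = 0}"
  hence k: "(\<Sum>a\<in>UNIV. k $ a * of_int (A a $ i)) = 0" for i by simp
  from spans_lattice_coefficients[OF spans] obtain C :: "'m \<Rightarrow> int ^ 'n"
    where C: "\<forall>i. (\<Sum>a\<in>UNIV. C i $ a *s A a) = axis i 1" ..
  define r where "r a = axis a 1 - (\<Sum>i\<in>UNIV. A a $ i *s C i)" for a
  have "r a \<in> relation_lattice A" for a
  proof -
    have "(\<Sum>e\<in>UNIV. r a $ e * A e $ j) = 0" for j
    proof -
      have Cj: "(\<Sum>e\<in>UNIV. C i $ e * A e $ j) = (if i = j then 1 else 0)" for i
        using arg_cong[OF C[rule_format, of i], of "\<lambda>v. v $ j"] by (simp add: axis_def)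
      have "(\<Sum>e\<in>UNIV. axis a 1 $ e * A e $ j) = A a $ j"
        by (subst sum.remove[of _ a]) (auto simp: axis_def intro!: sum.neutral)
      moreover have "(\<Sum>e\<in>UNIV. (\<Sum>i\<in>UNIV. A a $ i * C i $ e) * A e $ j) =
          (\<Sum>i\<in>UNIV. A a $ i * (\<Sum>e\<in>UNIV. C i $ e * A e $ j))"
        unfolding sum_distrib_left sum_distrib_right by (subst sum.swap) (simp add: mult_ac)
      ultimately show ?thesis
        by (simp add: r_def left_diff_distrib sum_subtractf Cj if_distrib cong: if_cong)
    qed
    thus ?thesis by (simp add: relation_lattice_def vec_eq_iff)
  qed
  hence "\<exists>y. r a = (\<chi> e. pairing (B e) y)" for a
    using gale unfolding gale_dual_def bij_betw_def by blast
  then obtain y where y: "\<And>a. r a = (\<chi> e. pairing (B e) (y a))" by metis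
  define Y :: "complex ^ 'd" where "Y = (\<Sum>a\<in>UNIV. k $ a *s (\<chi> j. of_int (y a $ j)))"
  have "pairing (B e) Y = k $ e" for e
  proof -
    have "pairing (B e) Y = (\<Sum>a\<in>UNIV. k $ a * pairing (B e) (\<chi> j. of_int (y a $ j)))"
      unfolding pairing_def Y_def sum_component sum_distrib_left
      by (subst sum.swap) (simp add: mult_ac)
    also have "\<dots> = (\<Sum>a\<in>UNIV. k $ a * of_int (r a $ e))"
      by (simp add: pairing_of_int y)
    also have "\<dots> = (\<Sum>a\<in>UNIV. k $ a * of_int (axis a 1 $ e)) -
        (\<Sum>a\<in>UNIV. \<Sum>i\<in>UNIV. k $ a * of_int (A a $ i) * of_int (C i $ e))"
      by (simp add: r_def algebra_simps sum_subtractf sum_distrib_left)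
    also have "(\<Sum>a\<in>UNIV. \<Sum>i\<in>UNIV. k $ a * of_int (A a $ i) * of_int (C i $ e)) =
        (\<Sum>i\<in>UNIV. (\<Sum>a\<in>UNIV. k $ a * of_int (A a $ i)) * of_int (C i $ e))"
      unfolding sum_distrib_right by (rule sum.swap)
    also have "\<dots> = 0" by (simp add: k)
    also have "(\<Sum>a\<in>UNIV. k $ a * of_int (axis a 1 $ e)) = k $ e"
      by (subst sum.remove[of _ e]) (auto simp: axis_def intro!: sum.neutral)
    finally show ?thesis by simp
  qed
  hence "lambda_B B Y = k" by (simp add: lambda_B_def vec_eq_iff)
  thus "k \<in> range (lambda_B B)" by blast
qed

lemma arrangement_compl_eq: "arrangement_compl B = range (lambda_B B) \<inter> complex_torus"
  by (auto simp: arrangement_compl_def arrangement_def lambda_B_def complex_torus_def)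

text \<open>
  The condition that \<open>c * y\<close> is a relation for some \<open>y\<close> in \<open>Y_A\<close> turns into a product decomposition
  of \<open>c\<close>, because the inverse of \<open>y\<close> is again in \<open>Y_A\<close>.
\<close>

lemma dual_variety_eq_closure:
  fixes A :: "'n::finite \<Rightarrow> int ^ 'm::finite" and B :: "'n \<Rightarrow> int ^ 'd::finite"
  assumes "spans_lattice A" and "gale_dual A B"
  shows "dual_variety A = closure {y * k | y k. y \<in> Y_A A \<and> k \<in> range (lambda_B B)}"
proof -
  have ker: "(\<forall>v\<in>tangent_space (Y_A A) (phi_A A x). (\<Sum>a\<in>UNIV. c $ a * v $ a) = 0) \<longleftrightarrow>
      c * phi_A A x \<in> range (lambda_B B)" if "x \<in> complex_torus" for x c
    unfolding annihilates_tangent_space_iff[OF assms(1) that]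
      complex_kernel_eq_range_lambda_B[OF assms, symmetric] by blast
  define inv where "inv x = (\<chi> i. inverse (x $ i))" for x :: "complex ^ 'm"
  have inv: "inv x \<in> complex_torus" "phi_A A x * phi_A A (inv x) = 1"
    if "x \<in> complex_torus" for x
    using that phi_A_inverse[OF that, of A] by (auto simp: inv_def complex_torus_def)
  have "{c. \<exists>z\<in>Y_A A. \<forall>v\<in>tangent_space (Y_A A) z. (\<Sum>a\<in>UNIV. c $ a * v $ a) = 0} =
      {c. \<exists>x\<in>complex_torus. c * phi_A A x \<in> range (lambda_B B)}"
    using ker by (auto simp: Y_A_def)
  also have "\<dots> = {y * k | y k. y \<in> Y_A A \<and> k \<in> range (lambda_B B)}"
  proof (intro equalityI subsetI)
    fix c assume "c \<in> {c. \<exists>x\<in>complex_torus. c * phi_A A x \<in> range (lambda_B B)}"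
    then obtain x where x: "x \<in> complex_torus" "c * phi_A A x \<in> range (lambda_B B)" by blast
    have "c = phi_A A (inv x) * (c * phi_A A x)"
      using inv(2)[OF x(1)] by (metis mult.commute mult.left_commute mult_1)
    thus "c \<in> {y * k | y k. y \<in> Y_A A \<and> k \<in> range (lambda_B B)}"
      using x inv(1)[OF x(1)] unfolding Y_A_def by blast
  next
    fix c assume "c \<in> {y * k | y k. y \<in> Y_A A \<and> k \<in> range (lambda_B B)}"
    then obtain x k where x: "x \<in> complex_torus" "k \<in> range (lambda_B B)" "c = phi_A A x * k"
      unfolding Y_A_def by blast
    have "c * phi_A A (inv x) = k"
      using inv(2)[OF x(1)] x(3) by (metis mult.commute mult.left_commute mult_1)
    thus "c \<in> {c. \<exists>x\<in>complex_torus. c * phi_A A x \<in> range (lambda_B B)}"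
      using x inv(1)[OF x(1)] by blast
  qed
  finally show ?thesis by (simp add: dual_variety_def)
qed

section \<open>Closed coamoebas\<close>

lemma T_A_eq_coamoeba:
  fixes A :: "'n::finite \<Rightarrow> int ^ 'm::finite"
  shows "T_A A = coamoeba (Y_A A)"
proof -
  have arg: "compact_torus = ArgV ` (complex_torus :: (complex ^ 'm) set)"
    using ArgV_in_compact_torus ArgV_of_compact_torus compact_torus_subset
    by (metis (no_types, lifting) image_eqI image_subsetI subsetD subsetI subset_antisym)
  show ?thesis
    unfolding T_A_def Y_A_def coamoeba_def arg image_image ArgV_phi_A ..
qed

lemma compact_T_A: "compact (T_A A)"
  unfolding T_A_def
  by (intro compact_continuous_image compact_compact_torus
      continuous_on_subset[OF continuous_on_phi_A compact_torus_subset])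

lemma closure_continuous_image_compact:
  fixes f :: "'a::metric_space \<Rightarrow> 'b::metric_space"
  assumes f: "continuous_on (closure S) f" and S: "compact (closure S)"
  shows "closure (f ` S) = f ` closure S"
proof
  show "closure (f ` S) \<subseteq> f ` closure S"
    by (intro closure_minimal image_mono closure_subset compact_imp_closed
        compact_continuous_image f S)
  show "f ` closure S \<subseteq> closure (f ` S)"
    by (intro image_closure_subset f closed_closure closure_subset)
qed

lemma compact_closure_coamoeba:
  assumes "X \<subseteq> complex_torus"
  shows "compact (closure (coamoeba X))"
  using compact_Int_closed[OF compact_compact_torus closed_closure, of "coamoeba X"]
    closure_coamoeba_subset_compact_torus[OF assms] by (simp only: Int_absorb1)

text \<open>
  Multiplication is continuous, and the closure of a product set is the product of the closures.
\<close>

lemma closure_setmult_compact: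
  fixes S T :: "(complex ^ 'n) set"
  assumes T: "compact T" and S: "compact (closure S)"
  shows "closure {t * s | t s. t \<in> T \<and> s \<in> S} = {t * s | t s. t \<in> T \<and> s \<in> closure S}"
proof -
  let ?m = "\<lambda>p :: (complex ^ 'n) \<times> (complex ^ 'n). fst p * snd p"
  have im: "{t * s | t s. t \<in> T \<and> s \<in> R} = ?m ` (T \<times> R)" for R by (auto simp: image_def)
  have "continuous_on X ?m" for X
    unfolding times_vec_def by (intro continuous_intros)
  moreover have "closure (T \<times> S) = T \<times> closure S"
    using T by (simp add: closure_Times compact_imp_closed)
  ultimately show ?thesis
    unfolding im using closure_continuous_image_compact[of "T \<times> S" ?m] T S
    by (simp add: compact_Times)
qed

section \<open>Phase limits\<close>

text \<open>
  Points of the discriminant need not lie in the image of \<open>\<phi>\<^sub>B\<close>. This replaces them by points of the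
  image with almost the same argument and logarithm.
\<close>

lemma closure_torus_approx:
  assumes y: "y \<in> closure S" "y \<in> complex_torus" and "e > 0"
  obtains s where "s \<in> S" "dist (ArgV s) (ArgV y) < e" "dist (LogV s) (LogV y) < e"
proof -
  obtain x where x: "\<And>n. x n \<in> S" "x \<longlonglongrightarrow> y" using y(1) by (auto simp: closure_sequential)
  have "isCont ArgV y" "isCont LogV y"
    using continuous_on_ArgV continuous_on_LogV y(2)
    unfolding continuous_on_eq_continuous_at[OF open_complex_torus] by auto
  hence "(\<lambda>n. ArgV (x n)) \<longlonglongrightarrow> ArgV y" "(\<lambda>n. LogV (x n)) \<longlonglongrightarrow> LogV y"
    using x(2) isCont_tendsto_compose by blast+
  hence "\<forall>\<^sub>F n in sequentially. dist (ArgV (x n)) (ArgV y) < e \<and> dist (LogV (x n)) (LogV y) < e"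
    using \<open>e > 0\<close> by (intro eventually_conj tendstoD)
  then obtain n where "dist (ArgV (x n)) (ArgV y) < e" "dist (LogV (x n)) (LogV y) < e"
    by (auto simp: eventually_sequentially)
  with x(1) that show ?thesis by blast
qed

text \<open>
  Exponents with sum zero make the monomials invariant under scaling, so the bounded linear map
  induced on logarithms factors through the quotient by the line of constant vectors, whose norm is
  the distance from that line.
\<close>

lemma norm_LogV_phi_A_le:
  fixes M :: "'k::finite \<Rightarrow> int ^ 'n::finite"
  assumes sum0: "\<And>i. (\<Sum>a\<in>UNIV. M i $ a) = 0"
  shows "\<exists>K>0. \<forall>z\<in>complex_torus.
    norm (LogV (phi_A M z)) \<le> K * infdist (LogV z) (range (\<lambda>s::real. \<chi> a. s))"
proof -
  define P where "P v = (\<chi> i. pairing (M i) v)" for v :: "real ^ 'n"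
  have "linear P"
    by (rule linearI)
      (simp_all add: P_def pairing_def vec_eq_iff algebra_simps sum.distrib sum_distrib_left)
  then obtain K where K: "K > 0" "\<And>v. norm (P v) \<le> K * norm v"
    using linear_bounded_pos by blast
  have Pc: "P (\<chi> a. s) = 0" for s
    using sum0 by (simp add: P_def pairing_def vec_eq_iff flip: sum_distrib_right of_int_sum)
  have "norm (P v) / K \<le> infdist v (range (\<lambda>s. \<chi> a. s))" for v
  proof -
    have "norm (P v) / K \<le> dist v (\<chi> a. s)" for s
    proof -
      have "norm (P v) = norm (P (v - (\<chi> a. s)))"
        by (simp add: linear_diff[OF \<open>linear P\<close>] Pc)
      also have "\<dots> \<le> K * dist v (\<chi> a. s)" using K(2) by (simp add: dist_norm)
      finally show ?thesis using K(1) by (simp add: field_simps)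
    qed
    thus ?thesis by (subst infdist_notempty) (auto intro!: cINF_greatest)
  qed
  moreover have "LogV (phi_A M z) = P (LogV z)" if "z \<in> complex_torus" for z
    by (simp add: P_def vec_eq_iff LogV_phi_A[OF that])
  ultimately show ?thesis
    using K(1) by (intro exI[of _ K]) (simp add: field_simps)
qed

text \<open>
  The approximating points \<open>phi_A M (z i)\<close> have the same limit of arguments, and after passing to a
  subsequence so that the arguments of \<open>z i\<close> converge to some \<open>\<eta>\<close>, continuity gives
  \<open>\<theta> = phi_A M \<eta>\<close>. That \<open>z i\<close> is unbounded modulo scaling follows from \<open>norm_LogV_phi_A_le\<close>.
\<close>

lemma phase_limit_set_monomial_image:
  fixes M :: "'k::finite \<Rightarrow> int ^ 'n::finite"
  assumes sum0: "\<And>i. (\<Sum>a\<in>UNIV. M i $ a) = 0" and H: "H \<subseteq> complex_torus"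
  shows "phase_limit_set (closure (phi_A M ` H) \<inter> complex_torus) \<subseteq>
         phi_A M ` projective_phase_limit_set H"
proof
  fix \<theta> assume "\<theta> \<in> phase_limit_set (closure (phi_A M ` H) \<inter> complex_torus)"
  then obtain y where y: "\<And>i. y i \<in> closure (phi_A M ` H)" "\<And>i. y i \<in> complex_torus"
    and Log: "filterlim (\<lambda>i. norm (LogV (y i))) at_top sequentially"
    and Arg: "(\<lambda>i. ArgV (y i)) \<longlonglongrightarrow> \<theta>"
    unfolding phase_limit_set_def by blast
  have "\<exists>z. z \<in> H \<and> dist (ArgV (phi_A M z)) (ArgV (y i)) < 1 / Suc i
      \<and> dist (LogV (phi_A M z)) (LogV (y i)) < 1 / Suc i" for i
    using closure_torus_approx[OF y(1)[of i] y(2)[of i], of "1 / Suc i"] by fastforce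
  then obtain z where z: "\<And>i. z i \<in> H"
    and zArg: "\<And>i. dist (ArgV (phi_A M (z i))) (ArgV (y i)) < 1 / Suc i"
    and zLog: "\<And>i. dist (LogV (phi_A M (z i))) (LogV (y i)) < 1 / Suc i"
    by metis
  have zT: "z i \<in> complex_torus" for i using z H by blast
  obtain \<eta> r where \<eta>: "\<eta> \<in> compact_torus" "strict_mono r" "(\<lambda>i. ArgV (z (r i))) \<longlonglongrightarrow> \<eta>"
    using compact_compact_torus[unfolded compact_def, rule_format, of "\<lambda>i. ArgV (z i)"]
      ArgV_in_compact_torus[OF zT] by (auto simp: o_def)
  have "(\<lambda>i. ArgV (phi_A M (z i)) - ArgV (y i)) \<longlonglongrightarrow> 0"
    using zArg by (intro LIMSEQ_norm_0) (simp add: dist_norm)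
  hence "(\<lambda>i. ArgV (phi_A M (z i))) \<longlonglongrightarrow> \<theta>"
    by (rule Lim_transform[OF Arg])
  hence "(\<lambda>i. phi_A M (ArgV (z (r i)))) \<longlonglongrightarrow> \<theta>"
    using LIMSEQ_subseq_LIMSEQ[OF _ \<eta>(2)] by (fastforce simp: ArgV_phi_A o_def)
  moreover have "(\<lambda>i. phi_A M (ArgV (z (r i)))) \<longlonglongrightarrow> phi_A M \<eta>"
    by (rule continuous_on_tendsto_compose[OF continuous_on_phi_A \<eta>(3)])
       (use \<eta>(1) compact_torus_subset ArgV_in_compact_torus[OF zT] in
          \<open>auto intro!: always_eventually\<close>)
  ultimately have \<theta>: "\<theta> = phi_A M \<eta>" using LIMSEQ_unique by blast
  obtain K where K: "K > 0" "\<forall>z\<in>complex_torus.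
      norm (LogV (phi_A M z)) \<le> K * infdist (LogV z) (range (\<lambda>s::real. \<chi> a. s))"
    using norm_LogV_phi_A_le[of M, OF sum0] by blast
  have "(norm (LogV (y i)) - 1) / K \<le> infdist (LogV (z i)) (range (\<lambda>s. \<chi> a. s))" for i
  proof -
    have "dist (LogV (phi_A M (z i))) (LogV (y i)) \<le> 1"
      using zLog[of i] by (rule order.trans[OF less_imp_le]) (simp add: field_simps)
    hence "norm (LogV (y i)) - 1 \<le> norm (LogV (phi_A M (z i)))"
      using norm_triangle_ineq2[of "LogV (y i)" "LogV (phi_A M (z i))"]
      by (simp add: dist_norm norm_minus_commute)
    also have "\<dots> \<le> K * infdist (LogV (z i)) (range (\<lambda>s. \<chi> a. s))" using K(2) zT by blast
    finally show ?thesis using K(1) by (simp add: field_simps)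
  qed
  moreover have "filterlim (\<lambda>i. (norm (LogV (y i)) - 1) / K) at_top sequentially"
  proof -
    have "filterlim (\<lambda>i. (- 1 + norm (LogV (y i))) * (1 / K)) at_top sequentially"
      using K(1) by (intro filterlim_at_top_mult_tendsto_pos[OF tendsto_const]
          filterlim_tendsto_add_at_top[OF tendsto_const Log]) simp
    thus ?thesis by simp
  qed
  ultimately have "filterlim (\<lambda>i. infdist (LogV (z i)) (range (\<lambda>s. \<chi> a. s))) at_top sequentially"
    by (rule filterlim_at_top_mono[rotated, OF always_eventually, OF allI])
  hence "filterlim (\<lambda>i. infdist (LogV (z (r i))) (range (\<lambda>s. \<chi> a. s))) at_top sequentially"
    using filterlim_compose filterlim_subseq[OF \<eta>(2)] by blast
  hence "\<eta> \<in> projective_phase_limit_set H"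
    unfolding projective_phase_limit_set_def using z \<eta>(3)
    by (intro CollectI exI[of _ "\<lambda>i. z (r i)"]) simp
  thus "\<theta> \<in> phi_A M ` projective_phase_limit_set H" using \<theta> by blast
qed

section \<open>The closed coamoeba of the discriminant\<close>

theorem corollary3p7:
  fixes A :: "'n::finite \<Rightarrow> int ^ 'm::finite"
    and B :: "'n \<Rightarrow> int ^ 'd::finite"
  assumes card: "CARD('n) = CARD('m) + CARD('d)"
    and spans: "spans_lattice A"
    and affine: "on_affine_hyperplane A"
    and gale: "gale_dual A B"
    and not_pyramid: "\<forall>a. B a \<noteq> 0"
  shows "closure (coamoeba (dual_variety A \<inter> complex_torus)) =
           {t * s | t s. t \<in> T_A A \<and> s \<in> closure (coamoeba (arrangement_compl B))}
       \<and> closure (coamoeba (reduced_discriminant B)) =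
           phi_B B ` closure (coamoeba (arrangement_compl B))
       \<and> phase_limit_set (reduced_discriminant B) \<subseteq>
           phi_B B ` projective_phase_limit_set (arrangement_compl B)"
proof (intro conjI)
  let ?H = "arrangement_compl B"
  \<comment> \<open>the exponents of \<open>\<phi>\<^sub>B\<close>, that is, the columns of \<open>B\<close>\<close>
  define M where "M = (\<lambda>j. \<chi> a. B a $ j)"
  have phi_B: "phi_B B = phi_A M" unfolding M_def by (rule phi_B_eq_phi_A)
  have H: "?H \<subseteq> complex_torus" by (simp add: arrangement_compl_eq)
  have D: "reduced_discriminant B = closure (phi_A M ` ?H) \<inter> complex_torus"
    by (simp add: reduced_discriminant_def phi_B)

  let ?S = "{y * k | y k. y \<in> Y_A A \<and> k \<in> range (lambda_B B)}"
  have "y \<in> complex_torus" if "y \<in> Y_A A" for y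
    using that by (auto simp: Y_A_def phi_A_in_complex_torus)
  hence "y * k \<in> complex_torus \<longleftrightarrow> k \<in> complex_torus" if "y \<in> Y_A A" for y k
    using that by (auto simp: complex_torus_def)
  hence "?S \<inter> complex_torus = {y * k | y k. y \<in> Y_A A \<and> k \<in> ?H}"
    unfolding arrangement_compl_eq by blast
  hence "coamoeba (?S \<inter> complex_torus) = ArgV ` {y * k | y k. y \<in> Y_A A \<and> k \<in> ?H}"
    by (simp only: coamoeba_def)
  also have "\<dots> = {ArgV y * ArgV k | y k. y \<in> Y_A A \<and> k \<in> ?H}"
    unfolding ArgV_mult[symmetric] by blast
  also have "\<dots> = {t * s | t s. t \<in> T_A A \<and> s \<in> coamoeba ?H}"
    unfolding T_A_eq_coamoeba coamoeba_def by blast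
  finally have "coamoeba (?S \<inter> complex_torus) = {t * s | t s. t \<in> T_A A \<and> s \<in> coamoeba ?H}" .
  thus "closure (coamoeba (dual_variety A \<inter> complex_torus)) =
      {t * s | t s. t \<in> T_A A \<and> s \<in> closure (coamoeba ?H)}"
    unfolding dual_variety_eq_closure[OF spans gale] closure_coamoeba_closure
    by (simp only: closure_setmult_compact[OF compact_T_A compact_closure_coamoeba[OF H]])

  have "phi_A M ` ?H \<inter> complex_torus = phi_A M ` ?H"
    using H phi_A_in_complex_torus by blast
  hence "closure (coamoeba (reduced_discriminant B)) = closure (phi_A M ` coamoeba ?H)"
    unfolding D closure_coamoeba_closure by (simp add: coamoeba_def image_image ArgV_phi_A)
  also have "\<dots> = phi_A M ` closure (coamoeba ?H)"
    using closure_coamoeba_subset_compact_torus[OF H] compact_torus_subset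
    by (intro closure_continuous_image_compact compact_closure_coamoeba H
        continuous_on_subset[OF continuous_on_phi_A]) blast
  finally show "closure (coamoeba (reduced_discriminant B)) = phi_B B ` closure (coamoeba ?H)"
    by (simp add: phi_B)

  show "phase_limit_set (reduced_discriminant B) \<subseteq> phi_B B ` projective_phase_limit_set ?H"
    unfolding D phi_B using gale_dual_sum_eq_0[OF gale affine] H
    by (intro phase_limit_set_monomial_image) (simp_all add: M_def)
qed

end
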